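(* Let $\mathcal P=\{f_1,\dots,f_n\}\subset\mathcal D\{U^{\pm}\}$ be a system satisfying the standing assumptions. If $\mathcal P$ is super essential, then $$\bigcup_{f\in \mathrm{ps}(\mathcal P)}\mathfrak S_j(f)=[\gamma_j,M_j]\cap\mathbb N,\qquad j=1,\dots,n-1.$$ That is, $\mathrm{ps}(\mathcal P)$ is a system of $L$ polynomials in the $L-1$ algebraic indeterminates $\mathcal V(\mathcal P)$.
   Context: Let $n\ge 2$, let $\mathcal D$ be an ordinary differential domain with derivation $\partial$, and let $U=\{u_1,\dots,u_{n-1}\}$ be differential indeterminates over $\mathcal D$; $u_{j,k}$ is the $k$th derivative of $u_j$, $u_{j,0}=u_j$, and $0\in\mathbb N$. The ring $\mathcal D\{U^{\pm}\}=\mathcal D[u_{j,k},u_{j,k}^{-1}: 1\le j\le n-1,\ k\in\mathbb N]$ of Laurent differential polynomials is a differential ring under $\partial$. For $f=\sum_{\iota}\theta_\iota\omega_\iota$ with nonzero $\theta_\iota\in\mathcal D$ and distinct Laurent monomials $\omega_\iota$, let $\mathfrak S_j(f)=\{k\in\mathbb N: \partial\omega_\iota/\partial u_{j,k}\ne 0\text{ for some }\iota\}$, $\mathrm{ord}(f,u_j)=\max\mathfrak S_j(f)$, $\mathrm{lord}(f,u_j)=\min\mathfrak S_j(f)$ if $\mathfrak S_j(f)\neq\emptyset$, and both equal $-\infty$ otherwise. The order of $f$ is $\max_j\mathrm{ord}(f,u_j)$. Standing assumptions on $\mathcal P=\{f_1,\dots,f_n\}$: each $f_i$ has order $\ge 0$;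 the $f_i$ are $n$ distinct polynomials; for every $j\in\{1,\dots,n-1\}$ there is $i$ with $\mathfrak S_j(f_i)\ne\emptyset$. Let $o_{i,j}=\mathrm{ord}(f_i,u_j)$. Let $\Gamma_i$ be the set of bijections $\{1,\dots,n\}\setminus\{i\}\to\{1,\dots,n-1\}$ and $J_i=\max_{\mu\in\Gamma_i}\sum_{h\ne i}o_{h,\mu(h)}\in\mathbb N\cup\{-\infty\}$. $\mathcal P$ is super essential if $J_i\ge 0$ for all $i=1,\dots,n$. Let $\gamma_j=\min\{\mathrm{lord}(f_i,u_j): \mathfrak S_j(f_i)\neq\emptyset,\ 1\le i\le n\}$ and $\gamma=\sum_{j=1}^{n-1}\gamma_j$. For $\mathcal P$ super essential one has $J_i-\gamma\ge 0$. Let $\mathrm{ps}(\mathcal P)$ be the family of the $\partial^k f_i$, $1\le i\le n$, $0\le k\le J_i-\gamma$, indexed by the pairs $(i,k)$, so it consists of $L=\sum_{i=1}^n(J_i-\gamma+1)$ polynomials. Let $m_j=\max\{o_{i,j}+J_i: 1\le i\le n\}$, $M_j=m_j-\gamma$, and $\mathcal V(\mathcal P)=\{u_{j,k}: k\in[\gamma_j,M_j]\cap\mathbb N,\ 1\le j\le n-1\}$, which has $L-1$ elements. *)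

theory Defs
  imports
    "HOL-Library.Poly_Mapping"
    "HOL-Library.Extended_Real"
    "HOL-Library.FuncSet"
begin

locale differential_domain =
  fixes \<delta> :: "'a::idom \<Rightarrow> 'a"
  assumes delta_add: "\<delta> (a + b) = \<delta> a + \<delta> b"
    and delta_mult: "\<delta> (a * b) = \<delta> a * b + a * \<delta> b"

text \<open>
  The pair \<open>(j, k)\<close> stands for the indeterminate \<open>u\<^sub>j\<^sub>,\<^sub>k\<close>. A Laurent monomial is its finitely
  supported family of integer exponents, and a Laurent differential polynomial is the finitely
  supported family of its coefficients, with convolution as product. The variable index \<open>j\<close> ranges
  over all of \<open>nat\<close> in the type; the set \<open>laurent_dpolys n\<close> below restricts it to \<open>{1..n-1}\<close>.
\<close>

type_synonym indet = "nat \<times> nat"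
type_synonym lmonom = "indet \<Rightarrow>\<^sub>0 int"
type_synonym 'a laurent = "lmonom \<Rightarrow>\<^sub>0 'a"

definition U :: "indet \<Rightarrow> 'a::comm_ring_1 laurent" where
  "U v = Poly_Mapping.single (Poly_Mapping.single v 1) 1"

definition laurent_over :: "indet set \<Rightarrow> 'a::comm_ring_1 laurent set" where
  "laurent_over V = {f. \<forall>\<omega>\<in>Poly_Mapping.keys f. Poly_Mapping.keys \<omega> \<subseteq> V}"

definition laurent_dpolys :: "nat \<Rightarrow> 'a::comm_ring_1 laurent set" where
  "laurent_dpolys n = laurent_over ({1..n-1} \<times> UNIV)"

definition pdiff :: "indet \<Rightarrow> 'a::comm_ring_1 laurent \<Rightarrow> 'a laurent" where
  "pdiff v f = (\<Sum>\<omega>\<in>Poly_Mapping.keys f.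
     Poly_Mapping.single (\<omega> - Poly_Mapping.single v 1) (of_int (Poly_Mapping.lookup \<omega> v) * Poly_Mapping.lookup f \<omega>))"

definition vars :: "'a::comm_ring_1 laurent \<Rightarrow> indet set" where
  "vars f = (\<Union>\<omega>\<in>Poly_Mapping.keys f. Poly_Mapping.keys \<omega>)"

text \<open>
  The derivation of the ring of Laurent differential polynomials, by the chain rule: apply \<open>\<delta>\<close> to
  the coefficients and add \<open>\<Sum>\<^sub>j\<^sub>,\<^sub>k (\<partial>f/\<partial>u\<^sub>j\<^sub>,\<^sub>k) u\<^sub>j\<^sub>,\<^sub>k\<^sub>+\<^sub>1\<close>. The lemmas below show that this is indeed
  the derivation that extends \<open>\<delta>\<close> and maps \<open>u\<^sub>j\<^sub>,\<^sub>k\<close> to \<open>u\<^sub>j\<^sub>,\<^sub>k\<^sub>+\<^sub>1\<close>.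
\<close>

definition ldiff :: "('a::comm_ring_1 \<Rightarrow> 'a) \<Rightarrow> 'a laurent \<Rightarrow> 'a laurent" where
  "ldiff \<delta> f = Poly_Mapping.map \<delta> f + (\<Sum>(j, k)\<in>vars f. pdiff (j, k) f * U (j, Suc k))"

definition SS :: "nat \<Rightarrow> 'a::comm_ring_1 laurent \<Rightarrow> nat set" where
  "SS j f = {k. \<exists>\<omega>\<in>Poly_Mapping.keys f. pdiff (j, k) (Poly_Mapping.single \<omega> (1::'a)) \<noteq> 0}"

definition ord :: "'a::comm_ring_1 laurent \<Rightarrow> nat \<Rightarrow> ereal" where
  "ord f j = (if SS j f = {} then -\<infinity> else ereal (real (Max (SS j f))))"

definition lord :: "'a::comm_ring_1 laurent \<Rightarrow> nat \<Rightarrow> ereal" where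
  "lord f j = (if SS j f = {} then -\<infinity> else ereal (real (Min (SS j f))))"

definition total_ord :: "nat \<Rightarrow> 'a::comm_ring_1 laurent \<Rightarrow> ereal" where
  "total_ord n f = Max ((\<lambda>j. ord f j) ` {1..n-1})"

definition standing_assumptions :: "nat \<Rightarrow> (nat \<Rightarrow> 'a::comm_ring_1 laurent) \<Rightarrow> bool" where
  "standing_assumptions n f \<longleftrightarrow>
     (\<forall>i\<in>{1..n}. total_ord n (f i) \<ge> 0) \<and>
     inj_on f {1..n} \<and>
     (\<forall>j\<in>{1..n-1}. \<exists>i\<in>{1..n}. SS j (f i) \<noteq> {})"

text \<open>
  Extensional functions, so that the set of bijections is finite and its maximum makes sense.
\<close>

definition Gam :: "nat \<Rightarrow> nat \<Rightarrow> (nat \<Rightarrow> nat) set" where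
  "Gam n i = {\<mu> \<in> ({1..n} - {i}) \<rightarrow>\<^sub>E {1..n-1}. bij_betw \<mu> ({1..n} - {i}) {1..n-1}}"

definition Jnum :: "nat \<Rightarrow> (nat \<Rightarrow> 'a::comm_ring_1 laurent) \<Rightarrow> nat \<Rightarrow> ereal" where
  "Jnum n f i = Max ((\<lambda>\<mu>. \<Sum>h\<in>{1..n} - {i}. ord (f h) (\<mu> h)) ` Gam n i)"

definition super_essential :: "nat \<Rightarrow> (nat \<Rightarrow> 'a::comm_ring_1 laurent) \<Rightarrow> bool" where
  "super_essential n f \<longleftrightarrow> (\<forall>i\<in>{1..n}. Jnum n f i \<ge> 0)"

definition gam :: "nat \<Rightarrow> (nat \<Rightarrow> 'a::comm_ring_1 laurent) \<Rightarrow> nat \<Rightarrow> ereal" where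
  "gam n f j = Min ((\<lambda>i. lord (f i) j) ` {i \<in> {1..n}. SS j (f i) \<noteq> {}})"

definition gam_sum :: "nat \<Rightarrow> (nat \<Rightarrow> 'a::comm_ring_1 laurent) \<Rightarrow> ereal" where
  "gam_sum n f = (\<Sum>j\<in>{1..n-1}. gam n f j)"

definition ps_index :: "nat \<Rightarrow> (nat \<Rightarrow> 'a::comm_ring_1 laurent) \<Rightarrow> (nat \<times> nat) set" where
  "ps_index n f = {(i, k). i \<in> {1..n} \<and> ereal (real k) \<le> Jnum n f i - gam_sum n f}"

definition ps :: "('a::comm_ring_1 \<Rightarrow> 'a) \<Rightarrow> (nat \<Rightarrow> 'a laurent) \<Rightarrow> nat \<times> nat \<Rightarrow> 'a laurent" where
  "ps \<delta> f = (\<lambda>(i, k). (ldiff \<delta> ^^ k) (f i))"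

definition Lnum :: "nat \<Rightarrow> (nat \<Rightarrow> 'a::comm_ring_1 laurent) \<Rightarrow> ereal" where
  "Lnum n f = (\<Sum>i\<in>{1..n}. Jnum n f i - gam_sum n f + 1)"

definition mnum :: "nat \<Rightarrow> (nat \<Rightarrow> 'a::comm_ring_1 laurent) \<Rightarrow> nat \<Rightarrow> ereal" where
  "mnum n f j = Max ((\<lambda>i. ord (f i) j + Jnum n f i) ` {1..n})"

definition Mnum :: "nat \<Rightarrow> (nat \<Rightarrow> 'a::comm_ring_1 laurent) \<Rightarrow> nat \<Rightarrow> ereal" where
  "Mnum n f j = mnum n f j - gam_sum n f"

definition nat_interval :: "ereal \<Rightarrow> ereal \<Rightarrow> nat set" where
  "nat_interval a b = {k. a \<le> ereal (real k) \<and> ereal (real k) \<le> b}"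

definition VV :: "nat \<Rightarrow> (nat \<Rightarrow> 'a::comm_ring_1 laurent) \<Rightarrow> indet set" where
  "VV n f = {(j, k). j \<in> {1..n-1} \<and> k \<in> nat_interval (gam n f j) (Mnum n f j)}"

text \<open>
  The indeterminates that occur effectively, that is, with nonzero partial derivative of some
  monomial. In characteristic zero this is \<open>vars f\<close>; in characteristic \<open>p\<close> it may be smaller,
  since \<open>p\<close>-th powers are not seen.
\<close>

definition effective_indets :: "'a::comm_ring_1 laurent \<Rightarrow> indet set" where
  "effective_indets f = {(j, k). k \<in> SS j f}"

lemma finite_vars: "finite (vars f)"
  by (simp add: vars_def)

lemma pdiff_superset:
  assumes "finite A" "Poly_Mapping.keys f \<subseteq> A"
  shows "pdiff v f = (\<Sum>\<omega>\<in>A.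
     Poly_Mapping.single (\<omega> - Poly_Mapping.single v 1) (of_int (Poly_Mapping.lookup \<omega> v) * Poly_Mapping.lookup f \<omega>))"
  unfolding pdiff_def by (rule sum.mono_neutral_left) (use assms in \<open>auto simp: in_keys_iff\<close>)

lemma pdiff_add: "pdiff v (f + g) = pdiff v f + pdiff v g"
proof -
  have "Poly_Mapping.keys (f + g) \<subseteq> Poly_Mapping.keys f \<union> Poly_Mapping.keys g"
    by (rule Poly_Mapping.keys_add)
  then show ?thesis
    by (simp add: pdiff_superset[of "Poly_Mapping.keys f \<union> Poly_Mapping.keys g"] lookup_add algebra_simps single_add
        sum.distrib)
qed

lemma pdiff_single [simp]:
  "pdiff v (Poly_Mapping.single \<omega> c) =
     Poly_Mapping.single (\<omega> - Poly_Mapping.single v 1) (of_int (Poly_Mapping.lookup \<omega> v) * c)"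
  by (cases "c = 0") (auto simp: pdiff_def)

lemma poly_mapping_add_single_induct [case_names zero single add]:
  fixes f :: "'b \<Rightarrow>\<^sub>0 'c::comm_monoid_add"
  assumes "P 0" "\<And>\<omega> c. P (Poly_Mapping.single \<omega> c)"
    "\<And>f g. P f \<Longrightarrow> P g \<Longrightarrow> P (f + g)"
  shows "P f"
proof (induction f rule: update_induct)
  case const
  then show ?case using assms(1) by simp
next
  case (update f a b)
  have "Poly_Mapping.update a b f = f + Poly_Mapping.single a b"
    using update.hyps
    by (intro poly_mapping_eqI) (auto simp: lookup_update lookup_add lookup_single in_keys_iff when_def)
  then show ?case using assms(2,3) update by metis
qed

lemma bilinear_induct:
  fixes D :: "'a::comm_ring_1 laurent \<Rightarrow> 'a laurent"
  assumes add: "\<And>f g. D (f + g) = D f + D g"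
    and mono: "\<And>\<omega> \<omega>' a b. D (Poly_Mapping.single \<omega> a * Poly_Mapping.single \<omega>' b) =
      D (Poly_Mapping.single \<omega> a) * Poly_Mapping.single \<omega>' b +
      Poly_Mapping.single \<omega> a * D (Poly_Mapping.single \<omega>' b)"
  shows "D (f * g) = D f * g + f * D g"
proof -
  have [simp]: "D 0 = 0"
    using add[of 0 0] by simp
  have left: "D (Poly_Mapping.single \<omega> a * g) =
      D (Poly_Mapping.single \<omega> a) * g + Poly_Mapping.single \<omega> a * D g" for \<omega> a g
  proof (induction g rule: poly_mapping_add_single_induct)
    case (single \<omega>' b)
    show ?case by (rule mono)
  qed (simp_all add: add distrib_left)
  show ?thesis
  proof (induction f rule: poly_mapping_add_single_induct)
    case (single \<omega> a)
    show ?case by (rule left)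
  qed (simp_all add: add distrib_right)
qed

lemma pdiff_mult: "pdiff v (f * g) = pdiff v f * g + f * pdiff v g"
  by (rule bilinear_induct)
    (simp_all add: pdiff_add mult_single lookup_add algebra_simps flip: single_add)

lemma pdiff_eq_0: "v \<notin> vars f \<Longrightarrow> pdiff v f = 0"
  unfolding pdiff_def vars_def by (intro sum.neutral) (auto simp: in_keys_iff)

lemma ldiff_superset:
  assumes "finite A" "vars f \<subseteq> A"
  shows "ldiff \<delta> f = Poly_Mapping.map \<delta> f + (\<Sum>(j, k)\<in>A. pdiff (j, k) f * U (j, Suc k))"
proof -
  have "(\<Sum>(j, k)\<in>vars f. pdiff (j, k) f * U (j, Suc k)) =
      (\<Sum>(j, k)\<in>A. pdiff (j, k) f * U (j, Suc k))"
    by (rule sum.mono_neutral_left) (use assms in \<open>auto simp: pdiff_eq_0\<close>)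
  then show ?thesis by (simp add: ldiff_def)
qed

lemma vars_add: "vars (f + g) \<subseteq> vars f \<union> vars g"
  unfolding vars_def using Poly_Mapping.keys_add[of f g] by blast

lemma vars_mult: "vars (f * g) \<subseteq> vars f \<union> vars g"
proof
  fix v assume "v \<in> vars (f * g)"
  then obtain \<omega> where \<omega>: "\<omega> \<in> Poly_Mapping.keys (f * g)" "v \<in> Poly_Mapping.keys \<omega>"
    by (auto simp: vars_def)
  then obtain a b where "\<omega> = a + b" "a \<in> Poly_Mapping.keys f" "b \<in> Poly_Mapping.keys g"
    using Poly_Mapping.keys_mult[of f g] by blast
  then show "v \<in> vars f \<union> vars g"
    using \<omega> Poly_Mapping.keys_add[of a b] by (auto simp: vars_def)
qed

context differential_domain
begin

lemma delta_0 [simp]: "\<delta> 0 = 0"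
  using delta_add[of 0 0] by (metis add.right_neutral add_left_cancel)

lemma delta_1 [simp]: "\<delta> 1 = 0"
  using delta_mult[of 1 1] by (metis mult.left_neutral mult.right_neutral add.right_neutral add_left_cancel)

lemma map_add: "Poly_Mapping.map \<delta> (f + g) = Poly_Mapping.map \<delta> f + Poly_Mapping.map \<delta> (g :: 'a laurent)"
  by (intro poly_mapping_eqI) (auto simp: lookup_add Poly_Mapping.map.rep_eq delta_add when_def
      simp flip: delta_add)

lemma map_mult:
  "Poly_Mapping.map \<delta> (f * g) = Poly_Mapping.map \<delta> f * g + f * Poly_Mapping.map \<delta> (g :: 'a laurent)"
  by (rule bilinear_induct)
    (auto simp: map_add mult_single Poly_Mapping.map_single delta_mult single_add)

lemma ldiff_add: "ldiff \<delta> (f + g) = ldiff \<delta> f + ldiff \<delta> g"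
  using vars_add[of f g] finite_vars[of f] finite_vars[of g]
  by (simp add: ldiff_superset[of "vars f \<union> vars g"] map_add pdiff_add algebra_simps sum.distrib
      case_prod_unfold)

lemma ldiff_mult: "ldiff \<delta> (f * g) = ldiff \<delta> f * g + f * ldiff \<delta> g"
  using vars_mult[of f g] finite_vars[of f] finite_vars[of g]
  by (simp add: ldiff_superset[of "vars f \<union> vars g"] map_mult pdiff_mult algebra_simps sum.distrib
      case_prod_unfold sum_distrib_left)

lemma ldiff_const: "ldiff \<delta> (Poly_Mapping.single 0 c) = Poly_Mapping.single 0 (\<delta> c)"
  by (simp add: ldiff_def vars_def Poly_Mapping.map_single del: single_zero)

lemma ldiff_U: "ldiff \<delta> (U (j, k)) = U (j, Suc k)"
  by (simp add: ldiff_def vars_def U_def Poly_Mapping.map_single mult_single)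

end

lemma SS_iff:
  "k \<in> SS j f \<longleftrightarrow> (\<exists>\<omega>\<in>Poly_Mapping.keys f. of_int (Poly_Mapping.lookup \<omega> (j, k)) \<noteq> (0 :: 'a))"
  for f :: "'a::comm_ring_1 laurent"
proof -
  have "Poly_Mapping.single \<omega> c = 0 \<longleftrightarrow> c = 0" for \<omega> :: lmonom and c :: 'a
    by (metis lookup_single_eq lookup_zero single_zero)
  then show ?thesis by (simp add: SS_def)
qed

lemma of_int_eq_0_CHAR_0:
  assumes "CHAR('a::comm_ring_1) = 0"
  shows "of_int z = (0 :: 'a) \<longleftrightarrow> z = 0"
proof (cases z rule: int_cases2)
  case (nonneg k)
  then show ?thesis using assms by (simp add: of_nat_eq_0_iff_char_dvd)
next
  case (nonpos k)
  then show ?thesis using assms by (simp add: of_nat_eq_0_iff_char_dvd)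
qed

lemma effective_indets_CHAR_0:
  assumes "CHAR('a::comm_ring_1) = 0"
  shows "effective_indets (f :: 'a laurent) = vars f"
  by (auto simp: effective_indets_def vars_def SS_iff of_int_eq_0_CHAR_0[OF assms] in_keys_iff)

end

theory Submission
  imports Defs
begin

text \<open>
  Since \<open>\<partial>/\<partial>u\<^sub>j\<^sub>,\<^sub>k\<close> commutes with the derivation up to \<open>\<partial>/\<partial>u\<^sub>j\<^sub>,\<^sub>k\<^sub>-\<^sub>1\<close>, differentiating \<open>f\<close> shifts an
  occurring index by at most one, and if \<open>k\<close> occurs in \<open>f\<close> then \<open>k + 1\<close> occurs in \<open>f\<close> or in its
  derivative. Hence the derivatives of \<open>f\<^sub>i\<close> up to order \<open>t\<close> exhaust \<open>[s, s + t]\<close> for each occurring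
  \<open>s\<close>. For a fixed \<open>j\<close>, two such intervals cover \<open>[\<gamma>\<^sub>j, M\<^sub>j]\<close>: one starts at \<open>\<gamma>\<^sub>j\<close> in a row \<open>i\<close> of lowest
  order, the other at \<open>o\<^sub>r\<^sub>,\<^sub>j\<close> in a row \<open>r\<close> with \<open>o\<^sub>r\<^sub>,\<^sub>j + J\<^sub>r = m\<^sub>j\<close>. They meet because, by an exchange
  along alternating paths, \<open>r\<close> can be chosen such that some finite matching that avoids \<open>i\<close> sends
  \<open>r\<close> to \<open>j\<close>. The same exchange shows that \<open>o\<^sub>h\<^sub>,\<^sub>j + J\<^sub>h = m\<^sub>j\<close> on each edge \<open>(h, j)\<close> of an optimal
  matching, so \<open>\<Sum>\<^sub>j m\<^sub>j = \<Sum>\<^sub>i J\<^sub>i\<close>, which gives the count \<open>L - 1\<close> of the indeterminates.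
\<close>

section \<open>Indeterminates of derivatives\<close>

text \<open>Lowering the exponent of \<open>v\<close> by one is injective on Laurent monomials, so
  each coefficient of the partial derivative comes from a single monomial.\<close>

lemma lookup_pdiff:
  "Poly_Mapping.lookup (pdiff v f) \<omega> =
     of_int (Poly_Mapping.lookup \<omega> v + 1) * Poly_Mapping.lookup f (\<omega> + Poly_Mapping.single v 1)"
proof (induction f rule: poly_mapping_add_single_induct)
  case zero
  show ?case by (simp add: pdiff_def)
next
  case (single \<omega>' c)
  have "\<omega>' - Poly_Mapping.single v 1 = \<omega> \<longleftrightarrow> \<omega>' = \<omega> + Poly_Mapping.single v 1"
    by (auto simp: algebra_simps)
  then show ?case
    by (auto simp: lookup_single lookup_add when_def)
next
  case (add f g)
  then show ?case by (simp add: pdiff_add lookup_add algebra_simps)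
qed

text \<open>By \<open>lookup_pdiff\<close> nothing cancels between monomials, and without zero
  divisors an exponent that is nonzero in the ring cannot annihilate a coefficient. Occurrence can
  then be studied by the rules for \<open>pdiff\<close>.\<close>

lemma mem_SS_iff_pdiff: "k \<in> SS j f \<longleftrightarrow> pdiff (j, k) f \<noteq> 0" for f :: "'a::idom laurent"
proof
  assume "k \<in> SS j f"
  then obtain \<omega> where \<omega>: "Poly_Mapping.lookup f \<omega> \<noteq> 0" "of_int (Poly_Mapping.lookup \<omega> (j, k)) \<noteq> (0 :: 'a)"
    by (auto simp: SS_iff in_keys_iff)
  then have "Poly_Mapping.lookup (pdiff (j, k) f) (\<omega> - Poly_Mapping.single (j, k) 1) \<noteq> 0"
    by (simp add: lookup_pdiff lookup_minus)
  then show "pdiff (j, k) f \<noteq> 0" by auto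
next
  assume "pdiff (j, k) f \<noteq> 0"
  then obtain \<omega> where "Poly_Mapping.lookup (pdiff (j, k) f) \<omega> \<noteq> 0"
    by (metis lookup_zero poly_mapping_eqI)
  then show "k \<in> SS j f"
    unfolding SS_iff lookup_pdiff
    by (intro bexI[of _ "\<omega> + Poly_Mapping.single (j, k) 1"]) (auto simp: in_keys_iff lookup_add)
qed

lemma mem_SS_imp_mem_vars:
  assumes "k \<in> SS j f"
  shows "(j, k) \<in> vars f"
proof -
  obtain \<omega> where "\<omega> \<in> Poly_Mapping.keys f" "(j, k) \<in> Poly_Mapping.keys \<omega>"
    using assms unfolding SS_iff by (metis in_keys_iff of_int_0)
  then show ?thesis by (auto simp: vars_def)
qed

lemma finite_SS [simp]: "finite (SS j f)"
  by (rule finite_subset[of _ "snd ` vars f"]) (force dest: mem_SS_imp_mem_vars simp: finite_vars)+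

lemma pdiff_0 [simp]: "pdiff v 0 = 0"
  by (simp add: pdiff_def)

lemma pdiff_sum: "pdiff v (sum g A) = (\<Sum>x\<in>A. pdiff v (g x))"
  by (induction A rule: infinite_finite_induct) (simp_all add: pdiff_add)

lemma pdiff_commute: "pdiff v (pdiff w f) = pdiff w (pdiff v f)"
proof (cases "v = w")
  case False
  then show ?thesis
    by (intro poly_mapping_eqI) (simp add: lookup_pdiff lookup_add lookup_single add_ac)
qed simp

lemma pdiff_U: "pdiff v (U w) = (if v = w then 1 else 0)"
  by (auto simp: U_def lookup_single)

context differential_domain
begin

lemma delta_of_int_mult: "\<delta> (of_int z * a) = of_int z * \<delta> a"
proof -
  have neg: "\<delta> (- b) = - \<delta> b" for b
    using delta_add[of "- b" b] by (simp add: eq_neg_iff_add_eq_0)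
  have nat: "\<delta> (of_nat m * b) = of_nat m * \<delta> b" for m b
    by (induction m) (simp_all add: delta_add distrib_right)
  show ?thesis
    by (cases z rule: int_cases2) (simp_all add: nat neg)
qed

lemma ldiff_0 [simp]: "ldiff \<delta> 0 = 0"
  using ldiff_add[of 0 0] by simp

lemma pdiff_map: "pdiff v (Poly_Mapping.map \<delta> f) = Poly_Mapping.map \<delta> (pdiff v f)"
  by (intro poly_mapping_eqI)
    (auto simp: lookup_pdiff Poly_Mapping.map.rep_eq delta_of_int_mult when_def simp del: of_int_add)

text \<open>The extra term comes from the chain rule: among the factors
  \<open>U (j', Suc k')\<close> only the one with \<open>(j', Suc k') = (j, k)\<close> depends on
  the indeterminate \<open>(j, k)\<close>.\<close>

lemma pdiff_ldiff:
  "pdiff (j, k) (ldiff \<delta> f) =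
     ldiff \<delta> (pdiff (j, k) f) + (case k of 0 \<Rightarrow> 0 | Suc k' \<Rightarrow> pdiff (j, k') f)"
proof -
  \<comment> \<open>Only the summand at \<open>(j, k - 1)\<close> can survive; for
    \<open>k = 0\<close> this truncates to \<open>(j, 0)\<close>, where both sides vanish.\<close>
  define A where "A = vars f \<union> vars (pdiff (j, k) f) \<union> {(j, k - 1)}"
  have A: "finite A" "vars f \<subseteq> A" "vars (pdiff (j, k) f) \<subseteq> A" "(j, k - 1) \<in> A"
    by (auto simp: A_def finite_vars)
  have "(\<Sum>v\<in>A. pdiff v f * pdiff (j, k) (U (fst v, Suc (snd v)))) =
      (\<Sum>v\<in>A. if v = (j, k - 1) then (case k of 0 \<Rightarrow> 0 | Suc k' \<Rightarrow> pdiff (j, k') f) else 0)"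
    by (intro sum.cong) (auto simp: pdiff_U split: nat.splits)
  also have "\<dots> = (case k of 0 \<Rightarrow> 0 | Suc k' \<Rightarrow> pdiff (j, k') f)"
    using A by simp
  finally show ?thesis
    using A by (simp add: ldiff_superset[of A] pdiff_add pdiff_map pdiff_sum pdiff_mult case_prod_unfold
        sum.distrib pdiff_commute[of "(j, k)"])
qed

lemma SS_ldiff_subset: "SS j (ldiff \<delta> f) \<subseteq> SS j f \<union> Suc ` SS j f"
proof
  fix k assume "k \<in> SS j (ldiff \<delta> f)"
  then show "k \<in> SS j f \<union> Suc ` SS j f"
    by (cases k) (force simp: mem_SS_iff_pdiff pdiff_ldiff)+
qed

text \<open>If \<open>Suc k\<close> does not occur in \<open>f\<close>, the first term of
  \<open>pdiff_ldiff\<close> vanishes and the nonzero second one remains. If it does occur, the two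
  terms may cancel, hence the disjunction.\<close>

lemma Suc_mem_SS_ldiff: "k \<in> SS j f \<Longrightarrow> Suc k \<in> SS j f \<or> Suc k \<in> SS j (ldiff \<delta> f)"
  by (auto simp: mem_SS_iff_pdiff pdiff_ldiff)

lemma SS_funpow_ldiff_subset: "SS j ((ldiff \<delta> ^^ t) f) \<subseteq> {s + d | s d. s \<in> SS j f \<and> d \<le> t}"
proof (induction t)
  case (Suc t)
  show ?case
  proof
    fix k assume "k \<in> SS j ((ldiff \<delta> ^^ Suc t) f)"
    then obtain k' where "k' \<in> SS j ((ldiff \<delta> ^^ t) f)" "k = k' \<or> k = Suc k'"
      using SS_ldiff_subset by fastforce
    then obtain s d where "s \<in> SS j f" "d \<le> t" "k = s + d \<or> k = s + Suc d"
      using Suc by fastforce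
    then show "k \<in> {s + d | s d. s \<in> SS j f \<and> d \<le> Suc t}"
      using Suc_le_mono le_SucI by blast
  qed
qed simp

text \<open>The next index is either present already, and \<open>t\<close> stays, or it appears
  after one more derivation; so \<open>t\<close> may lag behind \<open>d\<close>.\<close>

lemma mem_SS_funpow_ldiff:
  assumes "s \<in> SS j f"
  shows "\<exists>t\<le>d. s + d \<in> SS j ((ldiff \<delta> ^^ t) f)"
proof (induction d)
  case 0
  show ?case using assms by simp
next
  case (Suc d)
  then obtain t where "t \<le> d" "s + d \<in> SS j ((ldiff \<delta> ^^ t) f)" by blast
  then show ?case
    using Suc_mem_SS_ldiff[of "s + d" j "(ldiff \<delta> ^^ t) f"]
    by (metis Suc_le_mono add_Suc_right comp_apply funpow.simps(2) le_SucI)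
qed

end

section \<open>Optimal matchings\<close>

text \<open>
  In the graph with the edges of \<open>\<mu>\<close> and \<open>\<nu>\<close>, the set \<open>S\<close> consists of the rows on the alternating
  path that leaves \<open>i\<close> along \<open>\<nu>\<close>; it ends when it first reaches the column \<open>j\<close>, which \<open>\<nu>\<close> covers
  twice. Exchanging \<open>\<mu>\<close> and \<open>\<nu>\<close> along this path gives the two new matchings.
\<close>

lemma matching_exchange:
  assumes fin: "finite R"
    and i: "i \<in> R" and \<mu>: "bij_betw \<mu> (R - {i}) C"
    and a: "a \<in> R" and b: "b \<in> R" and ab: "a \<noteq> b" and \<nu>a: "\<nu> a = j" and \<nu>b: "\<nu> b = j"
    and \<nu>: "bij_betw \<nu> (R - {a}) C"
    and h: "h \<in> R - {i}" and \<mu>h: "\<mu> h = j"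
  obtains S where "S \<subseteq> R" "i \<in> S" "h \<notin> S" "a \<notin> S \<or> b \<notin> S"
    "bij_betw (\<lambda>x. if x \<in> S then \<mu> x else \<nu> x) (R - {i}) C"
    "bij_betw (\<lambda>x. if x \<in> S then \<nu> x else \<mu> x) (R - {h}) C"
proof -
  \<comment> \<open>One step of the path: from row \<open>x\<close> along \<open>\<nu>\<close> to a
    column, then back along \<open>\<mu>\<close> to the row matched with it.\<close>
  define \<phi> where "\<phi> x = inv_into (R - {i}) \<mu> (\<nu> x)" for x
  have \<nu>_C: "\<nu> x \<in> C" if "x \<in> R" for x
    using that bij_betwE[OF \<nu>] b ab \<nu>a \<nu>b by (cases "x = a") (metis Diff_iff singletonD)+
  have \<phi>: "\<phi> x \<in> R - {i}" "\<mu> (\<phi> x) = \<nu> x" if "x \<in> R" for x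
    using \<nu>_C[OF that] \<mu> unfolding \<phi>_def bij_betw_def by (metis inv_into_into, metis f_inv_into_f)
  define S where "S = \<Inter> {T. i \<in> T \<and> T \<subseteq> R \<and> (\<forall>x\<in>T - {a, b}. \<phi> x \<in> T)}"
  have iS: "i \<in> S" and SR: "S \<subseteq> R" and closed: "\<And>x. x \<in> S - {a, b} \<Longrightarrow> \<phi> x \<in> S"
    unfolding S_def using i \<phi>(1) by blast+
  have S_least: "S \<subseteq> T" if "i \<in> T" "T \<subseteq> R" "\<forall>x\<in>T - {a, b}. \<phi> x \<in> T" for T
    unfolding S_def using that by (intro Inter_lower) simp
  \<comment> \<open>By minimality of \<open>S\<close>, every row of the path except its start has a
    predecessor.\<close>
  have gen: "x \<in> \<phi> ` (S - {a, b})" if "x \<in> S - {i}" for x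
  proof (rule ccontr)
    assume x: "x \<notin> \<phi> ` (S - {a, b})"
    have "S \<subseteq> S - {x}"
    proof (rule S_least)
      show "\<forall>y\<in>S - {x} - {a, b}. \<phi> y \<in> S - {x}"
        using x closed by blast
    qed (use that iS SR in auto)
    then show False using that by blast
  qed
  have \<mu>S: "\<mu> ` (S - {i}) = \<nu> ` (S - {a, b})"
  proof
    show "\<mu> ` (S - {i}) \<subseteq> \<nu> ` (S - {a, b})"
    proof
      fix c assume "c \<in> \<mu> ` (S - {i})"
      then obtain y where y: "y \<in> S - {a, b}" "c = \<mu> (\<phi> y)" using gen by blast
      then have "c = \<nu> y" using \<phi>(2) SR by blast
      then show "c \<in> \<nu> ` (S - {a, b})" using y by blast
    qed
    show "\<nu> ` (S - {a, b}) \<subseteq> \<mu> ` (S - {i})"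
    proof
      fix c assume "c \<in> \<nu> ` (S - {a, b})"
      then obtain y where y: "y \<in> S - {a, b}" "c = \<nu> y" by blast
      then have "\<phi> y \<in> S - {i}" "c = \<mu> (\<phi> y)" using \<phi>[of y] closed[of y] SR by auto
      then show "c \<in> \<mu> ` (S - {i})" by blast
    qed
  qed
  have inj\<mu>: "inj_on \<mu> (R - {i})" and im\<mu>: "\<mu> ` (R - {i}) = C"
    using \<mu> by (auto simp: bij_betw_def)
  have inja: "inj_on \<nu> (R - {a})"
    using \<nu> by (simp add: bij_betw_def)
  have only_ab: "x = a \<or> x = b" if "x \<in> R" "\<nu> x = j" for x
    using inja that b ab \<nu>b unfolding inj_on_def by blast
  have injb: "inj_on \<nu> (R - {b})"
  proof (rule inj_onI)
    fix x y assume xy: "x \<in> R - {b}" "y \<in> R - {b}" "\<nu> x = \<nu> y"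
    show "x = y"
    proof (cases "x = a \<or> y = a")
      case True
      then have "\<nu> x = j" "\<nu> y = j" using xy \<nu>a by auto
      then show ?thesis using only_ab xy by blast
    next
      case False
      then show ?thesis using inj_onD[OF inja xy(3)] xy by blast
    qed
  qed
  have im\<nu>: "\<nu> ` (R - {a}) = C" "\<nu> ` (R - {b}) = C"
  proof -
    show 1: "\<nu> ` (R - {a}) = C"
      using \<nu> by (simp add: bij_betw_def)
    have "j \<in> \<nu> ` (R - {a})" "j \<in> \<nu> ` (R - {b})"
      using imageI[of b "R - {a}" \<nu>] imageI[of a "R - {b}" \<nu>] unfolding \<nu>a \<nu>b
      using a b ab by simp_all
    then have "\<nu> ` insert a (R - {a}) = \<nu> ` (R - {a})" "\<nu> ` insert b (R - {b}) = \<nu> ` (R - {b})"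
      unfolding image_insert \<nu>a \<nu>b by (simp_all only: insert_absorb)
    then have "\<nu> ` (R - {a}) = \<nu> ` (R - {b})"
      using a b by (simp add: insert_absorb)
    then show "\<nu> ` (R - {b}) = C" using 1 by simp
  qed
  have hS: "h \<notin> S"
  proof
    assume "h \<in> S"
    then have "j \<in> \<nu> ` (S - {a, b})" using \<mu>S \<mu>h h by blast
    then show False using only_ab SR by blast
  qed
  have finS: "finite S" using fin SR finite_subset by blast
  \<comment> \<open>By \<open>\<mu>S\<close> two injective images agree, so exactly one row of
    \<open>S\<close> lies in \<open>{a, b}\<close>; it is the end \<open>c\<close> of the path
    below.\<close>
  have "card (S - {i}) = card (\<mu> ` (S - {i}))"
    by (rule card_image[symmetric], rule inj_on_subset[OF inj\<mu>]) (use SR in blast)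
  also have "\<dots> = card (S - {a, b})"
    unfolding \<mu>S by (rule card_image, rule inj_on_subset[OF inja]) (use SR in blast)
  finally have card: "card (S - {i}) = card (S - {a, b})" .
  have notboth: "\<not> (a \<in> S \<and> b \<in> S)"
  proof
    assume *: "a \<in> S \<and> b \<in> S"
    then have "card (S - {a, b}) = card S - 2" "card S \<ge> 2"
      using ab finS card_mono[OF finS, of "{a, b}"] by (auto simp: card_Diff_subset)
    then show False using card iS finS by (simp add: card_Diff_singleton)
  qed
  have notnone: "a \<in> S \<or> b \<in> S"
  proof (rule ccontr)
    assume "\<not> (a \<in> S \<or> b \<in> S)"
    then have "S - {a, b} = S" by blast
    then show False using card iS finS by (metis card_Diff1_less less_irrefl)
  qed
  obtain c where c: "c \<in> S" "\<nu> c = j" "S - {a, b} = S - {c}" "inj_on \<nu> (R - {c})" "\<nu> ` (R - {c}) = C"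
  proof (cases "a \<in> S")
    case True
    then show thesis using that[of a] notboth \<nu>a inja im\<nu>(1) by auto
  next
    case False
    then show thesis using that[of b] notnone \<nu>b injb im\<nu>(2) by auto
  qed
  have inj\<nu>S: "inj_on \<nu> S"
  proof (cases "a \<in> S")
    case True
    then show ?thesis using notboth SR by (intro inj_on_subset[OF injb]) blast
  next
    case False
    then show ?thesis using SR by (intro inj_on_subset[OF inja]) blast
  qed
  have "bij_betw (\<lambda>x. if x \<in> S then \<mu> x else \<nu> x) ((S - {i}) \<union> (R - S)) (\<nu> ` (S - {c}) \<union> \<nu> ` (R - S))"
  proof (rule bij_betw_combine)
    show "bij_betw (\<lambda>x. if x \<in> S then \<mu> x else \<nu> x) (S - {i}) (\<nu> ` (S - {c}))"
      unfolding bij_betw_def using \<mu>S c(3) SR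
      by (auto simp: inj_on_def intro: inj_onD[OF inj\<mu>])
    show "bij_betw (\<lambda>x. if x \<in> S then \<mu> x else \<nu> x) (R - S) (\<nu> ` (R - S))"
      unfolding bij_betw_def using c(1,4) by (auto simp: inj_on_def)
    show "\<nu> ` (S - {c}) \<inter> \<nu> ` (R - S) = {}"
      using c(1,4) SR unfolding inj_on_def by blast
  qed
  moreover have "(S - {i}) \<union> (R - S) = R - {i}" "(S - {c}) \<union> (R - S) = R - {c}"
    using SR iS c(1) by auto
  ultimately have 1: "bij_betw (\<lambda>x. if x \<in> S then \<mu> x else \<nu> x) (R - {i}) C"
    using c(5) by (metis image_Un)
  \<comment> \<open>On \<open>S\<close>, \<open>\<nu>\<close> covers the columns that
    \<open>\<mu>\<close> covers on \<open>S - {i}\<close> and also \<open>j\<close>, which replaces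
    the column given up by \<open>h\<close>.\<close>
  have \<nu>S: "\<nu> ` S = insert j (\<mu> ` (S - {i}))"
    using c \<mu>S by (metis insert_Diff image_insert)
  have "bij_betw (\<lambda>x. if x \<in> S then \<nu> x else \<mu> x) (S \<union> (R - S - {h}))
      (insert j (\<mu> ` (S - {i})) \<union> \<mu> ` (R - S - {h}))"
  proof (rule bij_betw_combine)
    show "bij_betw (\<lambda>x. if x \<in> S then \<nu> x else \<mu> x) S (insert j (\<mu> ` (S - {i})))"
      unfolding bij_betw_def \<nu>S[symmetric] using inj\<nu>S by (auto simp: inj_on_def)
    show "bij_betw (\<lambda>x. if x \<in> S then \<nu> x else \<mu> x) (R - S - {h}) (\<mu> ` (R - S - {h}))"
      unfolding bij_betw_def using iS inj\<mu> by (auto simp: inj_on_def)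
    show "insert j (\<mu> ` (S - {i})) \<inter> \<mu> ` (R - S - {h}) = {}"
      using \<mu>h h iS SR hS inj\<mu> unfolding inj_on_def by blast
  qed
  moreover have "S \<union> (R - S - {h}) = R - {h}"
    using SR hS by auto
  moreover have "insert j (\<mu> ` (S - {i})) \<union> \<mu> ` (R - S - {h}) = \<mu> ` (R - {i})"
    using \<mu>h h SR iS hS by auto
  ultimately have 2: "bij_betw (\<lambda>x. if x \<in> S then \<nu> x else \<mu> x) (R - {h}) C"
    using im\<mu> by simp
  from that[OF SR iS hS _ 1 2] notboth show thesis by blast
qed

text \<open>\<open>E\<close> marks the entries other than \<open>-\<infinity>\<close> and
  \<open>w\<close> gives their values, which keeps all weights natural. \<open>J i\<close> is the
  optimal weight without row \<open>i\<close>; the existence of a finite matching for each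
  \<open>i\<close> expresses super essentiality.\<close>

locale jacobi_matrix =
  fixes R :: "'r set" and C :: "'c set" and E :: "'r \<Rightarrow> 'c \<Rightarrow> bool" and w :: "'r \<Rightarrow> 'c \<Rightarrow> nat"
    and J :: "'r \<Rightarrow> nat"
  assumes finite_R: "finite R"
    and attained: "i \<in> R \<Longrightarrow> \<exists>\<mu>. bij_betw \<mu> (R - {i}) C \<and> (\<forall>x\<in>R - {i}. E x (\<mu> x)) \<and>
      (\<Sum>x\<in>R - {i}. w x (\<mu> x)) = J i"
    and upper: "i \<in> R \<Longrightarrow> bij_betw \<mu> (R - {i}) C \<Longrightarrow> (\<And>x. x \<in> R - {i} \<Longrightarrow> E x (\<mu> x)) \<Longrightarrow>
      (\<Sum>x\<in>R - {i}. w x (\<mu> x)) \<le> J i"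
begin

definition optimal :: "'r \<Rightarrow> ('r \<Rightarrow> 'c) \<Rightarrow> bool" where
  "optimal i \<mu> \<longleftrightarrow> bij_betw \<mu> (R - {i}) C \<and> (\<forall>x\<in>R - {i}. E x (\<mu> x)) \<and>
     (\<Sum>x\<in>R - {i}. w x (\<mu> x)) = J i"

text \<open>Adding the edge from \<open>i'\<close> to \<open>j\<close> to an optimal matching
  without \<open>i'\<close> covers \<open>j\<close> twice, as \<open>matching_exchange\<close>
  requires.\<close>

lemma optimal_extend:
  assumes i': "i' \<in> R" and E: "E i' j" and j: "j \<in> C"
  obtains b \<nu> where "b \<in> R" "b \<noteq> i'" "\<nu> b = j" "\<nu> i' = j" "bij_betw \<nu> (R - {i'}) C"
    "\<forall>x\<in>R. E x (\<nu> x)" "optimal i' \<nu>" "(\<Sum>x\<in>R. w x (\<nu> x)) = w i' j + J i'"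
proof -
  obtain \<nu>0 where \<nu>0: "bij_betw \<nu>0 (R - {i'}) C" "\<forall>x\<in>R - {i'}. E x (\<nu>0 x)"
    "(\<Sum>x\<in>R - {i'}. w x (\<nu>0 x)) = J i'"
    using attained[OF i'] by blast
  define \<nu> where "\<nu> = \<nu>0(i' := j)"
  have bij: "bij_betw \<nu> (R - {i'}) C"
    using \<nu>0(1) by (rule bij_betw_cong[THEN iffD1, rotated]) (auto simp: \<nu>_def)
  have sum: "(\<Sum>x\<in>R - {i'}. w x (\<nu> x)) = J i'"
    unfolding \<nu>0(3)[symmetric] by (rule sum.cong) (auto simp: \<nu>_def)
  obtain b where "b \<in> R - {i'}" "\<nu> b = j"
    using bij j unfolding bij_betw_def by (metis imageE)
  moreover have "(\<Sum>x\<in>R. w x (\<nu> x)) = w i' j + J i'"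
    using sum.remove[OF finite_R i', of "\<lambda>x. w x (\<nu> x)"] sum by (simp add: \<nu>_def)
  moreover have "\<forall>x\<in>R. E x (\<nu> x)"
    using \<nu>0(2) E by (auto simp: \<nu>_def)
  moreover have "\<nu> i' = j" by (simp add: \<nu>_def)
  ultimately show thesis
    using bij sum by (intro that[of b \<nu>]) (auto simp: optimal_def)
qed

text \<open>Exchanging \<open>\<mu>\<close> with an extended optimal matching preserves the total
  weight. The new matchings avoid \<open>i\<close> and \<open>h\<close>, so their weights are at
  most \<open>J i\<close> and \<open>J h\<close>.\<close>

lemma optimal_edge:
  assumes i: "i \<in> R" and opt: "optimal i \<mu>" and h: "h \<in> R - {i}" and i': "i' \<in> R" and E: "E i' (\<mu> h)"
  shows "w i' (\<mu> h) + J i' \<le> w h (\<mu> h) + J h"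
proof -
  define j where "j = \<mu> h"
  have \<mu>: "bij_betw \<mu> (R - {i}) C" "\<And>x. x \<in> R - {i} \<Longrightarrow> E x (\<mu> x)" "(\<Sum>x\<in>R - {i}. w x (\<mu> x)) = J i"
    using opt by (auto simp: optimal_def)
  have j: "j \<in> C" using \<mu>(1) h unfolding j_def bij_betw_def by blast
  obtain b \<nu> where \<nu>: "b \<in> R" "b \<noteq> i'" "\<nu> b = j" "\<nu> i' = j" "bij_betw \<nu> (R - {i'}) C"
    "\<forall>x\<in>R. E x (\<nu> x)" "optimal i' \<nu>" "(\<Sum>x\<in>R. w x (\<nu> x)) = w i' j + J i'"
    by (rule optimal_extend[OF i' E[folded j_def] j])
  obtain S where S: "S \<subseteq> R" "i \<in> S" "h \<notin> S" "i' \<notin> S \<or> b \<notin> S"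
    "bij_betw (\<lambda>x. if x \<in> S then \<mu> x else \<nu> x) (R - {i}) C"
    "bij_betw (\<lambda>x. if x \<in> S then \<nu> x else \<mu> x) (R - {h}) C"
    by (rule matching_exchange[OF finite_R i \<mu>(1) i' \<nu>(1) \<nu>(2)[symmetric] \<nu>(4) \<nu>(3) \<nu>(5) h j_def[symmetric]])
  let ?\<mu> = "\<lambda>x. if x \<in> S then \<mu> x else \<nu> x" and ?\<nu> = "\<lambda>x. if x \<in> S then \<nu> x else \<mu> x"
  have 1: "(\<Sum>x\<in>R - {i}. w x (?\<mu> x)) \<le> J i"
    by (rule upper[OF i S(5)]) (use \<mu> \<nu> in auto)
  have "(\<Sum>x\<in>R - {h}. w x (?\<nu> x)) \<le> J h"
    by (rule upper[OF _ S(6)]) (use h \<mu> \<nu> S(2) in auto)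
  then have 2: "(\<Sum>x\<in>R. w x (?\<nu> x)) \<le> w h j + J h"
    using sum.remove[OF finite_R, of h "\<lambda>x. w x (?\<nu> x)"] h S(3) by (simp add: j_def)
  \<comment> \<open>Each row other than \<open>i\<close> has the same two entries before and after;
    row \<open>i\<close> lies in \<open>S\<close> and contributes only its \<open>\<nu>\<close>
    entry.\<close>
  have "(\<Sum>x\<in>R - {i}. w x (?\<mu> x)) + (\<Sum>x\<in>R. w x (?\<nu> x)) =
      (\<Sum>x\<in>R - {i}. w x (?\<mu> x) + w x (?\<nu> x)) + w i (\<nu> i)"
    using sum.remove[OF finite_R i, of "\<lambda>x. w x (?\<nu> x)"] S(2) by (simp add: sum.distrib)
  also have "\<dots> = (\<Sum>x\<in>R - {i}. w x (\<mu> x) + w x (\<nu> x)) + w i (\<nu> i)"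
    by (rule arg_cong2[where f = "(+)"], rule sum.cong) (auto simp: add.commute)
  also have "\<dots> = J i + (w i' j + J i')"
    using sum.remove[OF finite_R i, of "\<lambda>x. w x (\<nu> x)"] \<mu>(3) \<nu>(8) by (simp add: sum.distrib)
  finally show ?thesis
    using 1 2 unfolding j_def by linarith
qed

text \<open>By \<open>optimal_edge\<close> every edge of an optimal matching attains
  \<open>m\<close> in its column. The weights of these edges add up to \<open>J i\<close>, which
  supplies the term of the omitted row \<open>i\<close>.\<close>

lemma sum_row_maxima:
  assumes ub: "\<And>i j. i \<in> R \<Longrightarrow> j \<in> C \<Longrightarrow> E i j \<Longrightarrow> w i j + J i \<le> m j"
    and att: "\<And>j. j \<in> C \<Longrightarrow> \<exists>i\<in>R. E i j \<and> m j = w i j + J i"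
    and ne: "R \<noteq> {}"
  shows "(\<Sum>j\<in>C. m j) = (\<Sum>i\<in>R. J i)"
proof -
  obtain i where i: "i \<in> R" using ne by blast
  obtain \<mu> where opt: "optimal i \<mu>"
    using attained[OF i] by (auto simp: optimal_def)
  then have \<mu>: "bij_betw \<mu> (R - {i}) C" "\<And>x. x \<in> R - {i} \<Longrightarrow> E x (\<mu> x)" "(\<Sum>x\<in>R - {i}. w x (\<mu> x)) = J i"
    by (auto simp: optimal_def)
  have "m (\<mu> h) = w h (\<mu> h) + J h" if h: "h \<in> R - {i}" for h
  proof (rule antisym)
    have C: "\<mu> h \<in> C" using \<mu>(1) h by (auto simp: bij_betw_def)
    show "m (\<mu> h) \<le> w h (\<mu> h) + J h"
      using att[OF C] optimal_edge[OF i opt h] by (elim bexE) simp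
    show "w h (\<mu> h) + J h \<le> m (\<mu> h)"
      using ub[of h] C \<mu>(2)[OF h] h by blast
  qed
  then have "(\<Sum>h\<in>R - {i}. m (\<mu> h)) = (\<Sum>h\<in>R - {i}. w h (\<mu> h) + J h)"
    by (intro sum.cong) auto
  also have "\<dots> = (\<Sum>i\<in>R. J i)"
    using sum.remove[OF finite_R i, of J] \<mu>(3) by (simp add: sum.distrib)
  finally show ?thesis
    using sum.reindex_bij_betw[OF \<mu>(1), of m] by simp
qed

text \<open>Rows \<open>i'\<close> and \<open>b\<close> both attain the maximum at \<open>j\<close>
  and are both sent there by \<open>\<nu>\<close>. At most one lies on the exchange path from
  \<open>i\<close>, so the other keeps its edge to \<open>j\<close> in a matching that avoids
  \<open>i\<close>.\<close>

lemma matching_through_max: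
  assumes i: "i \<in> R" and j: "j \<in> C"
    and i': "i' \<in> R" "E i' j"
    and max: "\<And>x. x \<in> R \<Longrightarrow> E x j \<Longrightarrow> w x j + J x \<le> w i' j + J i'"
  obtains r \<mu> where "r \<in> R - {i}" "w r j + J r = w i' j + J i'" "\<mu> r = j"
    "bij_betw \<mu> (R - {i}) C" "\<forall>x\<in>R - {i}. E x (\<mu> x)"
proof -
  obtain \<mu> where \<mu>: "bij_betw \<mu> (R - {i}) C" "\<And>x. x \<in> R - {i} \<Longrightarrow> E x (\<mu> x)"
    using attained[OF i] by blast
  obtain h where h: "h \<in> R - {i}" "\<mu> h = j"
    using \<mu>(1) j unfolding bij_betw_def by (metis imageE)
  obtain b \<nu> where \<nu>: "b \<in> R" "b \<noteq> i'" "\<nu> b = j" "\<nu> i' = j" "bij_betw \<nu> (R - {i'}) C"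
    "\<forall>x\<in>R. E x (\<nu> x)" "optimal i' \<nu>" "(\<Sum>x\<in>R. w x (\<nu> x)) = w i' j + J i'"
    by (rule optimal_extend[OF i' j])
  obtain S where S: "S \<subseteq> R" "i \<in> S" "h \<notin> S" "i' \<notin> S \<or> b \<notin> S"
    "bij_betw (\<lambda>x. if x \<in> S then \<mu> x else \<nu> x) (R - {i}) C"
    "bij_betw (\<lambda>x. if x \<in> S then \<nu> x else \<mu> x) (R - {h}) C"
    by (rule matching_exchange[OF finite_R i \<mu>(1) i'(1) \<nu>(1) \<nu>(2)[symmetric] \<nu>(4) \<nu>(3) \<nu>(5) h])
  \<comment> \<open>\<open>optimal_edge\<close> for the optimal matching \<open>\<nu>\<close>
    without \<open>i'\<close> gives one inequality, the hypothesis \<open>max\<close> the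
    other.\<close>
  have b: "w b j + J b = w i' j + J i'"
    using optimal_edge[OF i'(1) \<nu>(7), of b i'] max[of b] \<nu>(6) \<nu>(1-3) i' by (intro antisym) auto
  obtain r where r: "r \<in> R" "r \<notin> S" "w r j + J r = w i' j + J i'" "\<nu> r = j"
    using S(4) b \<nu>(1,3,4) i'(1) by blast
  show thesis
    by (rule that[of r "\<lambda>x. if x \<in> S then \<mu> x else \<nu> x"]) (use r S \<mu>(2) \<nu>(6) in auto)
qed

end

section \<open>Jacobi numbers of a system\<close>

text \<open>One entry \<open>-\<infinity>\<close> makes the whole sum \<open>-\<infinity>\<close>,
  as \<open>\<infinity>\<close> never occurs among orders.\<close>

lemma sum_ord:
  assumes "finite A"
  shows "(\<Sum>h\<in>A. ord (f h) (\<mu> h)) =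
    (if \<forall>h\<in>A. SS (\<mu> h) (f h) \<noteq> {} then ereal (real (\<Sum>h\<in>A. Max (SS (\<mu> h) (f h)))) else -\<infinity>)"
  using assms by (induction A rule: finite_induct) (auto simp: ord_def)

lemma finite_Gam: "finite (Gam n i)"
  unfolding Gam_def by (rule finite_subset[of _ "({1..n} - {i}) \<rightarrow>\<^sub>E {1..n-1}"]) (auto intro: finite_PiE)

lemma restrict_mem_Gam:
  assumes "bij_betw \<mu> ({1..n} - {i}) {1..n-1}"
  shows "restrict \<mu> ({1..n} - {i}) \<in> Gam n i"
proof -
  have "bij_betw (restrict \<mu> ({1..n} - {i})) ({1..n} - {i}) {1..n-1}"
    using assms by (rule bij_betw_cong[THEN iffD1, rotated]) simp
  then show ?thesis
    using bij_betwE[OF assms] by (auto simp: Gam_def)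
qed

text \<open>Both sides of the bijections have \<open>n - 1\<close> elements. Nonemptiness gives
  \<open>Max\<close> in \<open>Jnum\<close> its meaning.\<close>

lemma Gam_nonempty:
  assumes "i \<in> {1..n}"
  shows "Gam n i \<noteq> {}"
proof -
  have "card ({1..n} - {i}) = card {1..n-1}"
    using assms by (simp add: card_Diff_singleton)
  then obtain \<mu> where "bij_betw \<mu> ({1..n} - {i}) {1..n-1}"
    using finite_same_card_bij[of "{1..n} - {i}" "{1..n-1}"] by auto
  then show ?thesis using restrict_mem_Gam by blast
qed

text \<open>A maximizing matching of nonnegative value has no entry \<open>-\<infinity>\<close>, so
  its value is a natural number that bounds all finite matchings.\<close>

lemma super_essential_jacobi_matrix:
  fixes f :: "nat \<Rightarrow> 'a::comm_ring_1 laurent"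
  assumes "super_essential n f"
  obtains J where "\<And>i. i \<in> {1..n} \<Longrightarrow> Jnum n f i = ereal (real (J i))"
    "jacobi_matrix {1..n} {1..n-1} (\<lambda>i j. SS j (f i) \<noteq> {}) (\<lambda>i j. Max (SS j (f i))) J"
proof -
  define P where "P i m \<longleftrightarrow> Jnum n f i = ereal (real m) \<and>
      (\<exists>\<mu>. bij_betw \<mu> ({1..n} - {i}) {1..n-1} \<and> (\<forall>x\<in>{1..n} - {i}. SS (\<mu> x) (f x) \<noteq> {}) \<and>
        (\<Sum>x\<in>{1..n} - {i}. Max (SS (\<mu> x) (f x))) = m) \<and>
      (\<forall>\<mu>. bij_betw \<mu> ({1..n} - {i}) {1..n-1} \<longrightarrow> (\<forall>x\<in>{1..n} - {i}. SS (\<mu> x) (f x) \<noteq> {}) \<longrightarrow>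
        (\<Sum>x\<in>{1..n} - {i}. Max (SS (\<mu> x) (f x))) \<le> m)" for i m
  have "\<exists>m. P i m" if i: "i \<in> {1..n}" for i
  proof -
    let ?R = "{1..n} - {i}"
    let ?S = "(\<lambda>\<mu>. \<Sum>h\<in>?R. ord (f h) (\<mu> h)) ` Gam n i"
    have S: "finite ?S" "?S \<noteq> {}"
      using finite_Gam Gam_nonempty[OF i] by auto
    have "Jnum n f i \<in> ?S"
      unfolding Jnum_def using S by (rule Max_in)
    then obtain \<mu> where \<mu>: "\<mu> \<in> Gam n i" "Jnum n f i = (\<Sum>h\<in>?R. ord (f h) (\<mu> h))"
      by blast
    moreover have "Jnum n f i \<ge> 0"
      using assms i by (auto simp: super_essential_def)
    ultimately have feas: "\<forall>x\<in>?R. SS (\<mu> x) (f x) \<noteq> {}"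
      and J: "Jnum n f i = ereal (real (\<Sum>h\<in>?R. Max (SS (\<mu> h) (f h))))"
      unfolding sum_ord[OF finite_Diff[OF finite_atLeastAtMost]] by (auto split: if_splits)
    have "(\<Sum>x\<in>?R. Max (SS (\<mu>' x) (f x))) \<le> (\<Sum>h\<in>?R. Max (SS (\<mu> h) (f h)))"
      if \<mu>': "bij_betw \<mu>' ?R {1..n-1}" "\<forall>x\<in>?R. SS (\<mu>' x) (f x) \<noteq> {}" for \<mu>'
    proof -
      have "(\<Sum>h\<in>?R. ord (f h) (restrict \<mu>' ?R h)) \<le> Jnum n f i"
        unfolding Jnum_def using S(1) restrict_mem_Gam[OF \<mu>'(1)] by (intro Max_ge imageI)
      also have "(\<Sum>h\<in>?R. ord (f h) (restrict \<mu>' ?R h)) = (\<Sum>h\<in>?R. ord (f h) (\<mu>' h))"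
        by (rule sum.cong) auto
      also have "\<dots> = ereal (real (\<Sum>x\<in>?R. Max (SS (\<mu>' x) (f x))))"
        using \<mu>'(2) by (subst sum_ord) auto
      finally show ?thesis
        unfolding J ereal_less_eq of_nat_le_iff .
    qed
    then show ?thesis
      unfolding P_def using \<mu>(1) feas J by (intro exI[of _ "\<Sum>h\<in>?R. Max (SS (\<mu> h) (f h))"]) (auto simp: Gam_def)
  qed
  then obtain J where J: "\<And>i. i \<in> {1..n} \<Longrightarrow> P i (J i)"
    by metis
  have "jacobi_matrix {1..n} {1..n-1} (\<lambda>i j. SS j (f i) \<noteq> {}) (\<lambda>i j. Max (SS j (f i))) J"
  proof
    fix i assume i: "i \<in> {1..n}"
    show "\<exists>\<mu>. bij_betw \<mu> ({1..n} - {i}) {1..n-1} \<and> (\<forall>x\<in>{1..n} - {i}. SS (\<mu> x) (f x) \<noteq> {}) \<and>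
        (\<Sum>x\<in>{1..n} - {i}. Max (SS (\<mu> x) (f x))) = J i"
      using J[OF i] unfolding P_def by blast
    show "(\<Sum>x\<in>{1..n} - {i}. Max (SS (\<mu> x) (f x))) \<le> J i"
      if "bij_betw \<mu> ({1..n} - {i}) {1..n-1}" "\<And>x. x \<in> {1..n} - {i} \<Longrightarrow> SS (\<mu> x) (f x) \<noteq> {}" for \<mu>
      using J[OF i] that unfolding P_def by blast
  qed simp
  then show thesis using that J unfolding P_def by blast
qed

lemma nat_interval_ereal [simp]: "nat_interval (ereal (real a)) (ereal (real b)) = {a..b}"
  by (auto simp: nat_interval_def)

text \<open>The claim on \<open>L\<close> polynomials in \<open>L - 1\<close> indeterminates is
  expressed by two cardinalities and the effective indeterminates. Membership in
  \<open>laurent_over\<close> is restricted to characteristic zero, since in characteristic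
  \<open>p\<close> exponents divisible by \<open>p\<close> escape partial derivatives.\<close>

theorem theorem3p7:
  fixes \<delta> :: "'a::idom \<Rightarrow> 'a" and n :: nat and f :: "nat \<Rightarrow> 'a laurent"
  assumes "differential_domain \<delta>"
    and "n \<ge> 2"
    and "\<forall>i\<in>{1..n}. f i \<in> laurent_dpolys n"
    and "standing_assumptions n f"
    and "super_essential n f"
  shows "(\<forall>j\<in>{1..n-1}.
            (\<Union>p\<in>ps_index n f. SS j (ps \<delta> f p)) = nat_interval (gam n f j) (Mnum n f j)) \<and>
         finite (ps_index n f) \<and> ereal (real (card (ps_index n f))) = Lnum n f \<and>
         finite (VV n f) \<and> ereal (real (card (VV n f))) = Lnum n f - 1 \<and>
         (\<Union>p\<in>ps_index n f. effective_indets (ps \<delta> f p)) = VV n f \<and>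
         (CHAR('a) = 0 \<longrightarrow> (\<forall>p\<in>ps_index n f. ps \<delta> f p \<in> laurent_over (VV n f)))"
proof -
  interpret differential_domain \<delta> by fact

  \<comment> \<open>Order data of the system as natural numbers\<close>
  define R C where "R = {1..n}" and "C = {1..n-1}"
  obtain J where J: "\<And>i. i \<in> R \<Longrightarrow> Jnum n f i = ereal (real (J i))"
    and "jacobi_matrix R C (\<lambda>i j. SS j (f i) \<noteq> {}) (\<lambda>i j. Max (SS j (f i))) J"
    using super_essential_jacobi_matrix[OF assms(5)] unfolding R_def C_def by blast
  interpret jacobi_matrix R C "\<lambda>i j. SS j (f i) \<noteq> {}" "\<lambda>i j. Max (SS j (f i))" J by fact
  define I where "I j = {i \<in> R. SS j (f i) \<noteq> {}}" for j
  define g where "g j = Min ((\<lambda>i. Min (SS j (f i))) ` I j)" for j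
  define m where "m j = Max ((\<lambda>i. Max (SS j (f i)) + J i) ` I j)" for j
  define G where "G = sum g C"
  have "\<forall>j\<in>C. \<exists>i\<in>R. SS j (f i) \<noteq> {}"
    using assms(4) by (simp add: R_def C_def standing_assumptions_def)
  then have I: "finite (I j)" "j \<in> C \<Longrightarrow> I j \<noteq> {}" for j
    using finite_R by (auto simp: I_def)
  have gam: "gam n f j = ereal (real (g j))" if "j \<in> C" for j
  proof -
    have "ereal (real (g j)) = Min ((\<lambda>x. ereal (real x)) ` (\<lambda>i. Min (SS j (f i))) ` I j)"
      unfolding g_def using I that by (intro mono_Min_commute) (auto simp: mono_def)
    also have "(\<lambda>x. ereal (real x)) ` (\<lambda>i. Min (SS j (f i))) ` I j = (\<lambda>i. lord (f i) j) ` I j"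
      unfolding image_image by (rule image_cong) (auto simp: lord_def I_def)
    finally show ?thesis by (simp add: gam_def I_def R_def)
  qed
  have gam_sum: "gam_sum n f = ereal (real G)"
    unfolding gam_sum_def G_def using gam by (simp add: C_def)
  have g_le: "g j \<le> s" if "i \<in> R" "s \<in> SS j (f i)" for i j s
  proof -
    have "g j \<le> Min (SS j (f i))"
      unfolding g_def using I that by (intro Min_le) (auto simp: I_def)
    also have "\<dots> \<le> s" using that by simp
    finally show ?thesis .
  qed
  have g_le_Max: "g j \<le> Max (SS j (f i))" if "i \<in> R" "SS j (f i) \<noteq> {}" for i j
    using g_le[of i _ j] that by simp
  have m_ge: "Max (SS j (f i)) + J i \<le> m j" if "i \<in> R" "SS j (f i) \<noteq> {}" for i j
    unfolding m_def using I that by (intro Max_ge) (auto simp: I_def)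
  have m_attained: "\<exists>i\<in>R. SS j (f i) \<noteq> {} \<and> m j = Max (SS j (f i)) + J i" if "j \<in> C" for j
  proof -
    have "m j \<in> (\<lambda>i. Max (SS j (f i)) + J i) ` I j"
      unfolding m_def using I that by (intro Max_in) auto
    then show ?thesis by (auto simp: I_def)
  qed
  \<comment> \<open>Along an optimal matching the lowest orders sum to \<open>G\<close>, and each is
    at most the order in its place. Hence \<open>J i - G\<close> is exact on naturals.\<close>
  have G_le: "G \<le> J i" if i: "i \<in> R" for i
  proof -
    obtain \<mu> where \<mu>: "bij_betw \<mu> (R - {i}) C" "\<forall>x\<in>R - {i}. SS (\<mu> x) (f x) \<noteq> {}"
      "(\<Sum>x\<in>R - {i}. Max (SS (\<mu> x) (f x))) = J i"
      using attained[OF i] by blast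
    have "G = (\<Sum>x\<in>R - {i}. g (\<mu> x))"
      unfolding G_def using sum.reindex_bij_betw[OF \<mu>(1), of g] by simp
    also have "\<dots> \<le> J i"
      unfolding \<mu>(3)[symmetric] using \<mu>(2) g_le_Max by (intro sum_mono) auto
    finally show ?thesis .
  qed
  have g_le_m: "g j + G \<le> m j" if "j \<in> C" for j
    using m_attained[OF that] G_le g_le_Max by (metis add_mono)
  have G_le_m: "G \<le> m j" if "j \<in> C" for j
    using g_le_m[OF that] by simp
  \<comment> \<open>Rows outside \<open>I j\<close> contribute \<open>-\<infinity>\<close> and leave
    the maximum unchanged.\<close>
  have mnum: "mnum n f j = ereal (real (m j))" if j: "j \<in> C" for j
    unfolding mnum_def
  proof (rule Max_eqI)
    fix y assume "y \<in> (\<lambda>i. ord (f i) j + Jnum n f i) ` {1..n}"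
    then obtain i where "i \<in> R" "y = ord (f i) j + ereal (real (J i))"
      using J by (auto simp: R_def)
    then show "y \<le> ereal (real (m j))"
      using m_ge[of i j] by (auto simp: ord_def simp flip: of_nat_add)
  next
    obtain i where "i \<in> R" "SS j (f i) \<noteq> {}" "m j = Max (SS j (f i)) + J i"
      using m_attained[OF j] by blast
    then show "ereal (real (m j)) \<in> (\<lambda>i. ord (f i) j + Jnum n f i) ` {1..n}"
      using J by (intro image_eqI[of _ _ i]) (auto simp: ord_def R_def)
  qed simp
  have Mnum: "Mnum n f j = ereal (real (m j - G))" if "j \<in> C" for j
    using G_le_m[OF that] by (simp add: Mnum_def mnum[OF that] gam_sum of_nat_diff)
  have ps_index: "ps_index n f = Sigma R (\<lambda>i. {..J i - G})"
    using J G_le by (auto simp: ps_index_def R_def gam_sum simp flip: of_nat_diff)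
  have VV: "VV n f = Sigma C (\<lambda>j. {g j..m j - G})"
    using gam Mnum by (auto simp: VV_def C_def)

  \<comment> \<open>Indices occurring in the differentiated system\<close>
  have union: "(\<Union>p\<in>ps_index n f. SS j (ps \<delta> f p)) = {g j..m j - G}" if j: "j \<in> C" for j
  proof (intro equalityI subsetI)
    fix k assume "k \<in> (\<Union>p\<in>ps_index n f. SS j (ps \<delta> f p))"
    then obtain i t where it: "i \<in> R" "t \<le> J i - G" "k \<in> SS j ((ldiff \<delta> ^^ t) (f i))"
      by (auto simp: ps_index ps_def)
    then obtain s d where sd: "s \<in> SS j (f i)" "d \<le> t" "k = s + d"
      using SS_funpow_ldiff_subset by fastforce
    then have bounds: "g j \<le> s" "s \<le> Max (SS j (f i))" "Max (SS j (f i)) + J i \<le> m j"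
      using g_le[of i s j] m_ge[of i j] it by auto
    have "s + d \<le> m j - G"
      using bounds it(2) sd(2) G_le[OF it(1)] by linarith
    then show "k \<in> {g j..m j - G}"
      using bounds(1) sd(3) by simp
  next
    fix k assume k: "k \<in> {g j..m j - G}"
    \<comment> \<open>Row \<open>i\<close> alone yields the interval of length
      \<open>J i - G\<close> from \<open>s\<close> on: the required \<open>t\<close> is at most
      \<open>k - s\<close>, hence admissible in \<open>ps_index n f\<close>.\<close>
    have cover: "k \<in> (\<Union>p\<in>ps_index n f. SS j (ps \<delta> f p))"
      if i_s: "i \<in> R" "s \<in> SS j (f i)" "s \<le> k" "k \<le> s + (J i - G)" for i s
    proof -
      obtain t where t: "t \<le> k - s" "k \<in> SS j ((ldiff \<delta> ^^ t) (f i))"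
        using mem_SS_funpow_ldiff[OF i_s(2), of "k - s"] i_s(3) by auto
      then have "(i, t) \<in> ps_index n f"
        using i_s by (auto simp: ps_index)
      then show ?thesis
        using t(2) by (force simp: ps_def)
    qed
    have "g j \<in> (\<lambda>i. Min (SS j (f i))) ` I j"
      unfolding g_def using I j by (intro Min_in) auto
    then obtain i where i: "i \<in> R" "SS j (f i) \<noteq> {}" "g j = Min (SS j (f i))"
      by (auto simp: I_def)
    then have gi: "g j \<in> SS j (f i)" by simp
    obtain i' where i': "i' \<in> R" "SS j (f i') \<noteq> {}" "m j = Max (SS j (f i')) + J i'"
      using m_attained[OF j] by blast
    have max: "Max (SS j (f x)) + J x \<le> Max (SS j (f i')) + J i'" if "x \<in> R" "SS j (f x) \<noteq> {}" for x
      using m_ge[OF that] i'(3) by simp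
    obtain r \<mu> where r: "r \<in> R - {i}" "Max (SS j (f r)) + J r = Max (SS j (f i')) + J i'" "\<mu> r = j"
      and \<mu>: "bij_betw \<mu> (R - {i}) C" "\<forall>x\<in>R - {i}. SS (\<mu> x) (f x) \<noteq> {}"
      by (rule matching_through_max[OF i(1) j i'(1,2) max])
    have fin: "finite (R - {i})" using finite_R by simp
    \<comment> \<open>Bounding all edges of \<open>\<mu>\<close> except \<open>(r, j)\<close> below
      by lowest orders shows that the interval of row \<open>r\<close> starts no later than that of
      row \<open>i\<close> ends.\<close>
    have "G = (\<Sum>x\<in>R - {i}. g (\<mu> x))"
      unfolding G_def using sum.reindex_bij_betw[OF \<mu>(1), of g] by simp
    also have "\<dots> = g j + (\<Sum>x\<in>R - {i} - {r}. g (\<mu> x))"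
      using sum.remove[OF fin r(1), of "\<lambda>x. g (\<mu> x)"] r(3) by simp
    finally have "Max (SS j (f r)) + G = g j + (Max (SS j (f r)) + (\<Sum>x\<in>R - {i} - {r}. g (\<mu> x)))"
      by simp
    also have "\<dots> \<le> g j + (Max (SS j (f r)) + (\<Sum>x\<in>R - {i} - {r}. Max (SS (\<mu> x) (f x))))"
      using \<mu>(2) g_le_Max by (intro add_left_mono sum_mono) auto
    also have "\<dots> = g j + (\<Sum>x\<in>R - {i}. Max (SS (\<mu> x) (f x)))"
      using sum.remove[OF fin r(1), of "\<lambda>x. Max (SS (\<mu> x) (f x))"] r(3) by simp
    also have "\<dots> \<le> g j + J i"
      using upper[OF i(1) \<mu>(1)] \<mu>(2) by simp
    finally have key: "Max (SS j (f r)) + G \<le> g j + J i" .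
    show "k \<in> (\<Union>p\<in>ps_index n f. SS j (ps \<delta> f p))"
    proof (cases "k \<le> g j + (J i - G)")
      case True
      then show ?thesis using cover[OF i(1) gi] k by auto
    next
      case False
      have rR: "r \<in> R" and "Max (SS j (f r)) \<in> SS j (f r)"
        using r \<mu>(2) by auto
      moreover have "Max (SS j (f r)) \<le> k"
        using False key G_le[OF i(1)] by linarith
      moreover have "k \<le> Max (SS j (f r)) + (J r - G)"
        using k r(2) i'(3) G_le[OF rR] by auto
      ultimately show ?thesis by (rule cover)
    qed
  qed
  \<comment> \<open>Derivation shifts only the second component of an index pair, so
    \<open>j\<close> stays in the range prescribed by \<open>laurent_dpolys n\<close>.\<close>
  have SS_C: "j \<in> C" if p: "p \<in> ps_index n f" and k: "k \<in> SS j (ps \<delta> f p)" for j k p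
  proof -
    obtain i t where it: "i \<in> R" "p = (i, t)" using p by (auto simp: ps_index)
    then obtain s where "s \<in> SS j (f i)"
      using k SS_funpow_ldiff_subset[of j t "f i"] by (auto simp: ps_def)
    then have "(j, s) \<in> vars (f i)" by (rule mem_SS_imp_mem_vars)
    moreover have "vars (f i) \<subseteq> C \<times> UNIV"
      using assms(3) it(1) unfolding laurent_dpolys_def laurent_over_def vars_def R_def C_def by blast
    ultimately show ?thesis by blast
  qed
  have eff: "(\<Union>p\<in>ps_index n f. effective_indets (ps \<delta> f p)) = VV n f"
  proof (intro set_eqI)
    fix v :: indet
    obtain j k where v: "v = (j, k)" by fastforce
    have "v \<in> (\<Union>p\<in>ps_index n f. effective_indets (ps \<delta> f p)) \<longleftrightarrow>
        j \<in> C \<and> k \<in> (\<Union>p\<in>ps_index n f. SS j (ps \<delta> f p))"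
      using SS_C v by (auto simp: effective_indets_def)
    also have "\<dots> \<longleftrightarrow> v \<in> VV n f"
      unfolding v VV mem_Sigma_iff using union[of j] by blast
    finally show "v \<in> (\<Union>p\<in>ps_index n f. effective_indets (ps \<delta> f p)) \<longleftrightarrow> v \<in> VV n f" .
  qed

  \<comment> \<open>Counting polynomials and indeterminates\<close>
  have card_ps: "card (ps_index n f) = (\<Sum>i\<in>R. J i - G + 1)"
    unfolding ps_index using finite_R by simp
  have "Lnum n f = (\<Sum>i\<in>R. ereal (real (J i - G + 1)))"
    unfolding Lnum_def R_def[symmetric] using J G_le
    by (intro sum.cong) (auto simp: gam_sum of_nat_diff one_ereal_def)
  then have Lnum: "Lnum n f = ereal (real (card (ps_index n f)))"
    unfolding card_ps by simp
  have "card (VV n f) = (\<Sum>j\<in>C. m j - G + 1 - g j)"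
    unfolding VV by (simp add: C_def)
  \<comment> \<open>By \<open>g_le_m\<close> the truncated subtraction loses nothing.\<close>
  moreover have "real (m j - G + 1 - g j) = real (m j) - real G + 1 - real (g j)" if "j \<in> C" for j
    using g_le_m[OF that] by linarith
  ultimately have "real (card (VV n f)) = (\<Sum>j\<in>C. real (m j) - real G + 1 - real (g j))"
    by simp
  also have "\<dots> = real (sum m C) - real (card C) * real G + real (card C) - real G"
    by (simp add: sum.distrib sum_subtractf G_def)
  also have "sum m C = sum J R"
    using assms(2) m_ge m_attained by (intro sum_row_maxima) (auto simp: R_def)
  \<comment> \<open>There is one row more than columns: the separate \<open>G\<close> completes the
    term of that row, and \<open>-1\<close> remains.\<close>
  also have "real (card C) = real (card R) - 1"
    using assms(2) by (simp add: C_def R_def of_nat_diff)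
  also have "real (sum J R) - (real (card R) - 1) * real G + (real (card R) - 1) - real G =
      (\<Sum>i\<in>R. real (J i) - real G + 1) - 1"
    by (simp add: sum.distrib sum_subtractf algebra_simps)
  also have "(\<Sum>i\<in>R. real (J i) - real G + 1) = real (card (ps_index n f))"
    unfolding card_ps of_nat_sum using G_le by (intro sum.cong) (auto simp: of_nat_diff)
  finally have card_VV: "real (card (VV n f)) = real (card (ps_index n f)) - 1" .
  have "ps \<delta> f p \<in> laurent_over (VV n f)" if "CHAR('a) = 0" "p \<in> ps_index n f" for p
  proof -
    have "vars (ps \<delta> f p) \<subseteq> VV n f"
      using effective_indets_CHAR_0[OF that(1)] eff that(2) by blast
    then show ?thesis by (auto simp: laurent_over_def vars_def)
  qed
  moreover have "finite (ps_index n f)" "finite (VV n f)"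
    unfolding ps_index VV by (auto simp: finite_R C_def)
  moreover have "ereal (real (card (VV n f))) = Lnum n f - 1"
    by (simp add: Lnum card_VV one_ereal_def)
  moreover have "\<forall>j\<in>{1..n-1}. (\<Union>p\<in>ps_index n f. SS j (ps \<delta> f p)) = nat_interval (gam n f j) (Mnum n f j)"
    unfolding C_def[symmetric] by (intro ballI) (simp only: union gam Mnum nat_interval_ereal)
  ultimately show ?thesis
    using eff Lnum by (intro conjI impI) simp_all
qed

end
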